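(* Let $G=(V,E)$ be the digraph with vertex set $V=\{s_1,u_1,v_1,u_2,v_2,u_3,v_3,a_1,a_2\}$ and the directed edges $$s_1\to u_2,\quad s_1\to v_1,\quad s_1\to v_2,\quad u_1\to u_2,\quad u_2\to u_1,\quad v_1\to u_3,\quad u_3\to v_1,\quad v_2\to v_3,\quad v_3\to v_2,$$ $$u_1\to v_1,\quad v_1\to v_2,\quad v_2\to a_1,\quad u_2\to u_3,\quad u_3\to v_3,\quad v_3\to a_2 .$$ Consider the deterministic graphical (DG) game on $G$ with initial position $s_1$ and three players $I=\{1,2,3\}$. Player 1 controls $V_1=\{s_1,u_1,v_1\}$, player 2 controls $V_2=\{u_2,v_2\}$, player 3 controls $V_3=\{u_3,v_3\}$, and the terminals are $V_T=\{a_1,a_2\}$. The game has exactly five outcomes: two terminal outcomes $a_1,a_2$, and three cyclic outcomes $c_1,c_2,c_3$ corresponding to the strongly connected components $\{u_1,u_2\}$, $\{v_1,u_3\}$, $\{v_2,v_3\}$, respectively. Let the preferences of the players over the outcomes be $$\text{player 1: } c_1 \prec_1 a_1 \prec_1 c_2 \prec_1 c_3 \prec_1 a_2,$$ $$\text{player 2: } a_2 \prec_2 c_1 \prec_2 c_2 \prec_2 a_1 \prec_2 c_3,$$ $$\text{player 3: } c_3 \prec_3 c_1 \prec_3 a_2 \prec_3 c_2 \prec_3 a_1 .$$ Then this game has no Nash equilibrium in pure stationary strategies, and its rank vector is $r=(r_1,r_2,r_3)=(1,2,1)$. Consequently, it is false that for every finite $n$-person DG game without Nash equilibria in pure stationary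 strategies at least two entries of the rank vector are at least $2$.
   Context: A finite $n$-person deterministic graphical (DG) game consists of the following data. (1) A finite digraph $G=(V,E)$, whose vertices are called positions and whose edges are called moves, with an initial position $v_0\in V\setminus V_T$ and a partition $V=V_1\cup\dots\cup V_n\cup V_T$. Here $V_T$ is the set of terminals (vertices with no outgoing edge) and $V_i$ is the set of positions controlled by player $i\in I=\{1,\dots,n\}$. By convention a loop is added at each terminal. (2) A set of outcomes $\Omega$. There is one outcome for each strongly connected component (SCC) of $G$ that contains a directed cycle (loops count as directed cycles, including the loops added at terminals). An SCC consisting of a single vertex without a loop is called transient and has no outcome. An outcome is called terminal if no edge leaves the corresponding SCC (for example, if the SCC is a terminal vertex with its loop); every other outcome is called cyclic (or inner). (3) For each player $i$, a strict linear order $\succ_i$ on $\Omega$, where $\omega\succ_i\omega'$ (equivalently $\omega'\prec_i\omega$) means that $i$ prefers $\omega$ to $\omega'$. A pure stationary strategy $x_i$ of player $i$ assigns to each position $v\in V_i$ one move $(v,v')\in E$ from $v$; let $X_i$ be the set of such strategies. A strategy profile $x=(x_1,\dots,x_n)\in X=X_1\times\dots\times X_n$ determines a unique walk (play) from $v_0$ which follows the chosen move in each position. Since the strategies are stationary, this play is an initial directed path (possibly empty) followed by a directed cycle repeated infinitely, where the cycle may be the loop at a terminal. The outcome $g(x)\in\Omega$ is the one corresponding to the SCC containing that cycle. A profile $x\in X$ is a Nash equilibrium (NE) in pure stationary strategies if there are no player $i\in I$ and profile $x'\in X$ with $x'_j=x_j$ for all $j\ne i$ such that $g(x')\succ_i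 g(x)$. The rank vector of the game is $r=(r_1,\dots,r_n)$, where $r_i$ is the number of terminal outcomes $a$ for which there exists a cyclic outcome $c$ with $c\succ_i a$. *)

theory Defs
  imports "Graph_Theory.Graph_Theory" "HOL-Library.Disjoint_Sets" "HOL-Library.Infinite_Set"
begin

section \<open>Deterministic graphical games\<close>

text \<open>
  The players are \<open>1, \<dots>, num_players\<close> and \<open>control i\<close> is the set of positions of player \<open>i\<close>.
  Outcomes are represented by the vertex sets of the corresponding strongly connected components,
  and \<open>(\<omega>, \<omega>') \<in> pref i\<close> means that player \<open>i\<close> strictly prefers \<open>\<omega>'\<close> to \<open>\<omega>\<close>.
  The graph is given without the loops that are added at terminals by convention.
\<close>

record 'v dg_game =
  game_graph :: "'v pair_pre_digraph"
  init_pos :: 'v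
  num_players :: nat
  control :: "nat \<Rightarrow> 'v set"
  pref :: "nat \<Rightarrow> 'v set rel"

definition players :: "'v dg_game \<Rightarrow> nat set" where
  "players g = {1..num_players g}"

definition terminals :: "'v dg_game \<Rightarrow> 'v set" where
  "terminals g = {v \<in> pverts (game_graph g). out_arcs (with_proj (game_graph g)) v = {}}"

definition looped_graph :: "'v dg_game \<Rightarrow> 'v pair_pre_digraph" where
  "looped_graph g =
     (game_graph g)\<lparr>parcs := parcs (game_graph g) \<union> {(v, v) |v. v \<in> terminals g}\<rparr>"

definition outcomes :: "'v dg_game \<Rightarrow> 'v set set" where
  "outcomes g = {C \<in> pre_digraph.sccs_verts (with_proj (looped_graph g)).
                   \<exists>p. pre_digraph.cycle (with_proj (looped_graph g) \<restriction> C) p}"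

definition terminal_outcomes :: "'v dg_game \<Rightarrow> 'v set set" where
  "terminal_outcomes g =
     {C \<in> outcomes g. \<not> (\<exists>(u, v) \<in> parcs (looped_graph g). u \<in> C \<and> v \<notin> C)}"

definition cyclic_outcomes :: "'v dg_game \<Rightarrow> 'v set set" where
  "cyclic_outcomes g = outcomes g - terminal_outcomes g"

locale finite_dg_game =
  fixes g :: "'v dg_game"
  assumes finite_digraph: "pair_fin_digraph (game_graph g)"
    and init_pos_in: "init_pos g \<in> pverts (game_graph g) - terminals g"
    and positions_cover:
      "(\<Union>i\<in>players g. control g i) \<union> terminals g = pverts (game_graph g)"
    and control_disjoint: "disjoint_family_on (control g) (players g)"
    and control_nonterminal: "\<And>i. i \<in> players g \<Longrightarrow> control g i \<inter> terminals g = {}"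
    and pref_on_outcomes: "\<And>i. i \<in> players g \<Longrightarrow> pref g i \<subseteq> outcomes g \<times> outcomes g"
    and pref_strict_linear: "\<And>i. i \<in> players g \<Longrightarrow> strict_linear_order_on (outcomes g) (pref g i)"

definition strategies :: "'v dg_game \<Rightarrow> nat \<Rightarrow> ('v \<Rightarrow> 'v \<times> 'v) set" where
  "strategies g i = (\<Pi>\<^sub>E v\<in>control g i. out_arcs (with_proj (game_graph g)) v)"

definition profiles :: "'v dg_game \<Rightarrow> (nat \<Rightarrow> 'v \<Rightarrow> 'v \<times> 'v) set" where
  "profiles g = (\<Pi>\<^sub>E i\<in>players g. strategies g i)"

definition controller :: "'v dg_game \<Rightarrow> 'v \<Rightarrow> nat" where
  "controller g v = (THE i. i \<in> players g \<and> v \<in> control g i)"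

definition next_pos :: "'v dg_game \<Rightarrow> (nat \<Rightarrow> 'v \<Rightarrow> 'v \<times> 'v) \<Rightarrow> 'v \<Rightarrow> 'v" where
  "next_pos g x v = (if v \<in> terminals g then v else snd (x (controller g v) v))"

primrec play :: "'v dg_game \<Rightarrow> (nat \<Rightarrow> 'v \<Rightarrow> 'v \<times> 'v) \<Rightarrow> nat \<Rightarrow> 'v" where
  "play g x 0 = init_pos g"
| "play g x (Suc k) = next_pos g x (play g x k)"

text \<open>
  A play is eventually periodic, so the positions of the cycle it ends in are exactly
  the positions it visits infinitely often.
\<close>

definition play_cycle :: "'v dg_game \<Rightarrow> (nat \<Rightarrow> 'v \<Rightarrow> 'v \<times> 'v) \<Rightarrow> 'v set" where
  "play_cycle g x = {v. \<exists>\<^sub>\<infinity>k. play g x k = v}"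

definition outcome :: "'v dg_game \<Rightarrow> (nat \<Rightarrow> 'v \<Rightarrow> 'v \<times> 'v) \<Rightarrow> 'v set" where
  "outcome g x = (THE C. C \<in> outcomes g \<and> play_cycle g x \<subseteq> C)"

definition nash_equilibrium :: "'v dg_game \<Rightarrow> (nat \<Rightarrow> 'v \<Rightarrow> 'v \<times> 'v) \<Rightarrow> bool" where
  "nash_equilibrium g x \<longleftrightarrow> x \<in> profiles g \<and>
     \<not> (\<exists>i \<in> players g. \<exists>x' \<in> profiles g.
          (\<forall>j \<in> players g. j \<noteq> i \<longrightarrow> x' j = x j) \<and> (outcome g x, outcome g x') \<in> pref g i)"

definition rank :: "'v dg_game \<Rightarrow> nat \<Rightarrow> nat" where
  "rank g i = card {a \<in> terminal_outcomes g. \<exists>c \<in> cyclic_outcomes g. (a, c) \<in> pref g i}"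

definition rank_vector :: "'v dg_game \<Rightarrow> nat list" where
  "rank_vector g = map (rank g) [1..<Suc (num_players g)]"


section \<open>The three-person game\<close>

text \<open>
  Positions are natural numbers, so that the game lives in a type in which every finite
  game can be represented up to isomorphism.
\<close>

definition s\<^sub>1 :: nat where "s\<^sub>1 = 0"
definition u\<^sub>1 :: nat where "u\<^sub>1 = 1"
definition v\<^sub>1 :: nat where "v\<^sub>1 = 2"
definition u\<^sub>2 :: nat where "u\<^sub>2 = 3"
definition v\<^sub>2 :: nat where "v\<^sub>2 = 4"
definition u\<^sub>3 :: nat where "u\<^sub>3 = 5"
definition v\<^sub>3 :: nat where "v\<^sub>3 = 6"
definition a\<^sub>1 :: nat where "a\<^sub>1 = 7"
definition a\<^sub>2 :: nat where "a\<^sub>2 = 8"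

definition A\<^sub>1 :: "nat set" where "A\<^sub>1 = {a\<^sub>1}"
definition A\<^sub>2 :: "nat set" where "A\<^sub>2 = {a\<^sub>2}"
definition C\<^sub>1 :: "nat set" where "C\<^sub>1 = {u\<^sub>1, u\<^sub>2}"
definition C\<^sub>2 :: "nat set" where "C\<^sub>2 = {v\<^sub>1, u\<^sub>3}"
definition C\<^sub>3 :: "nat set" where "C\<^sub>3 = {v\<^sub>2, v\<^sub>3}"

text \<open>The strict order that lists the given elements from worst to best.\<close>

definition chain_order :: "'a list \<Rightarrow> 'a rel" where
  "chain_order xs = {(xs ! j, xs ! k) |j k. j < k \<and> k < length xs}"

definition three_person_game :: "nat dg_game" where
  "three_person_game = \<lparr>
     game_graph = \<lparr>
       pverts = {s\<^sub>1, u\<^sub>1, v\<^sub>1, u\<^sub>2, v\<^sub>2, u\<^sub>3, v\<^sub>3, a\<^sub>1, a\<^sub>2},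
       parcs = {(s\<^sub>1, u\<^sub>2), (s\<^sub>1, v\<^sub>1), (s\<^sub>1, v\<^sub>2), (u\<^sub>1, u\<^sub>2), (u\<^sub>2, u\<^sub>1),
                (v\<^sub>1, u\<^sub>3), (u\<^sub>3, v\<^sub>1), (v\<^sub>2, v\<^sub>3), (v\<^sub>3, v\<^sub>2),
                (u\<^sub>1, v\<^sub>1), (v\<^sub>1, v\<^sub>2), (v\<^sub>2, a\<^sub>1), (u\<^sub>2, u\<^sub>3), (u\<^sub>3, v\<^sub>3), (v\<^sub>3, a\<^sub>2)}\<rparr>,
     init_pos = s\<^sub>1,
     num_players = 3,
     control = (\<lambda>i. if i = 1 then {s\<^sub>1, u\<^sub>1, v\<^sub>1}
                    else if i = 2 then {u\<^sub>2, v\<^sub>2}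
                    else if i = 3 then {u\<^sub>3, v\<^sub>3} else {}),
     pref = (\<lambda>i. if i = 1 then chain_order [C\<^sub>1, A\<^sub>1, C\<^sub>2, C\<^sub>3, A\<^sub>2]
                 else if i = 2 then chain_order [A\<^sub>2, C\<^sub>1, C\<^sub>2, A\<^sub>1, C\<^sub>3]
                 else if i = 3 then chain_order [C\<^sub>3, C\<^sub>1, A\<^sub>2, C\<^sub>2, A\<^sub>1] else {})\<rparr>"

end

theory Submission
  imports Defs
begin

text \<open>
  The strongly connected components are ordered linearly, so the outcome of a profile is found
  component by component, from the terminals backwards, as an explicit function of the moves
  chosen in the seven nonterminal positions. Six unilateral deviations, two for each player,
  are enough to improve on every one of the 192 profiles.
\<close>

section \<open>Strongly connected components from a level function\<close>

lemma reachable_level_mono: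
  fixes lvl :: "'a \<Rightarrow> 'b::preorder"
  assumes "u \<rightarrow>\<^sup>*\<^bsub>G\<^esub> v" and "\<And>u v. u \<rightarrow>\<^bsub>G\<^esub> v \<Longrightarrow> lvl u \<le> lvl v"
  shows "lvl u \<le> lvl v"
  using assms(1) unfolding reachable_def
  by (induction rule: rtrancl_on_induct) (auto intro: order_trans assms(2))

text \<open>Levels cannot drop along a walk, so antisymmetry forces mutually reachable vertices onto
  one level; \<open>conn\<close> gives the converse. Computing the components thus becomes a check
  of single arcs and of pairs of vertices on the same level.\<close>

lemma sccs_verts_eq_level_sets:
  fixes lvl :: "'a \<Rightarrow> 'b::order"
  assumes mono: "\<And>u v. u \<rightarrow>\<^bsub>G\<^esub> v \<Longrightarrow> lvl u \<le> lvl v"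
    and conn: "\<And>u v. u \<in> verts G \<Longrightarrow> v \<in> verts G \<Longrightarrow> lvl u = lvl v \<Longrightarrow> u \<rightarrow>\<^sup>*\<^bsub>G\<^esub> v"
  shows "pre_digraph.sccs_verts G = (\<lambda>u. {v \<in> verts G. lvl v = lvl u}) ` verts G"
proof -
  have same: "u \<in> verts G \<and> v \<in> verts G \<and> lvl u = lvl v"
    if uv: "u \<rightarrow>\<^sup>*\<^bsub>G\<^esub> v" and vu: "v \<rightarrow>\<^sup>*\<^bsub>G\<^esub> u" for u v
  proof -
    have "lvl u \<le> lvl v" "lvl v \<le> lvl u"
      using uv vu mono by (blast intro: reachable_level_mono)+
    then show ?thesis
      using uv by (auto simp: reachable_def dest: in_rtrancl_on_in_F)
  qed
  show ?thesis
  proof (intro set_eqI iffI)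
    fix S assume S: "S \<in> pre_digraph.sccs_verts G"
    then obtain u where u: "u \<in> S" by (auto simp: pre_digraph.sccs_verts_def)
    have in_S: "v \<in> S \<longleftrightarrow> v \<in> verts G \<and> lvl v = lvl u" for v
    proof -
      have "v \<in> S \<longleftrightarrow> u \<rightarrow>\<^sup>*\<^bsub>G\<^esub> v \<and> v \<rightarrow>\<^sup>*\<^bsub>G\<^esub> u"
        using S u unfolding pre_digraph.sccs_verts_def by blast
      \<comment> \<open>Any two members of a component reach each other, in particular
        \<open>u\<close> reaches itself, and reachability includes being a vertex.\<close>
      moreover have "u \<in> verts G"
        using S u same[of u u] unfolding pre_digraph.sccs_verts_def by blast
      ultimately show ?thesis
        using same[of u v] conn[of u v] conn[of v u] by metis
    qed
    then have "u \<in> verts G" using u by blast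
    then show "S \<in> (\<lambda>u. {v \<in> verts G. lvl v = lvl u}) ` verts G"
      using in_S by blast
  next
    fix S assume "S \<in> (\<lambda>u. {v \<in> verts G. lvl v = lvl u}) ` verts G"
    then obtain u where u: "u \<in> verts G" and S: "S = {v \<in> verts G. lvl v = lvl u}" by blast
    have "v \<rightarrow>\<^sup>*\<^bsub>G\<^esub> w" if "v \<in> S" "w \<in> S" for v w
      using that conn unfolding S by simp
    moreover have "w \<in> S" if "v \<in> S" "v \<rightarrow>\<^sup>*\<^bsub>G\<^esub> w" "w \<rightarrow>\<^sup>*\<^bsub>G\<^esub> v" for v w
      using same[OF that(2,3)] that(1) unfolding S by simp
    moreover have "u \<in> S" using u unfolding S by simp
    ultimately show "S \<in> pre_digraph.sccs_verts G"
      unfolding pre_digraph.sccs_verts_def by blast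
  qed
qed

section \<open>Plays, outcomes and unilateral deviations in an arbitrary game\<close>

lemma play_eq_funpow: "play g x k = (next_pos g x ^^ k) (init_pos g)"
  by (induction k) auto

context finite_dg_game
begin

lemma controller_eq:
  assumes "i \<in> players g" "v \<in> control g i"
  shows "controller g v = i"
  unfolding controller_def
  using assms control_disjoint by (fastforce simp: disjoint_family_on_def)

lemma next_pos_control:
  assumes "i \<in> players g" "v \<in> control g i"
  shows "next_pos g x v = snd (x i v)"
  using assms control_nonterminal[OF assms(1)] by (auto simp: next_pos_def controller_eq)

lemma next_pos_arc:
  assumes "x \<in> profiles g" "i \<in> players g" "v \<in> control g i"
  shows "(v, next_pos g x v) \<in> parcs (game_graph g)"
proof -
  have "x i v \<in> out_arcs (with_proj (game_graph g)) v"
    using assms by (auto simp: profiles_def strategies_def PiE_def Pi_def)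
  then show ?thesis
    by (cases "x i v") (auto simp: next_pos_control[OF assms(2,3)] out_arcs_def)
qed

text \<open>A component that the play enters and that the chosen moves never leave traps the play.
  All positions visited infinitely often then lie in it, and distinct components are disjoint, so no
  other outcome fits the definite description.\<close>

lemma outcome_eqI:
  assumes C: "C \<in> outcomes g" and k: "(next_pos g x ^^ k) (init_pos g) \<in> C"
    and closed: "next_pos g x ` C \<subseteq> C"
  shows "outcome g x = C"
proof -
  have stay: "play g x (k + j) \<in> C" for j
    using k closed by (induction j) (auto simp: play_eq_funpow)
  have CV: "C \<subseteq> pverts (game_graph g)"
    using C by (force simp: outcomes_def pre_digraph.sccs_verts_def reachable_def looped_graph_def
        dest: in_rtrancl_on_in_F)
  then have fin: "finite C"
    using finite_digraph finite_subset pair_fin_digraph.pair_finite_verts by blast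
  have "play_cycle g x \<subseteq> C"
  proof
    fix v assume "v \<in> play_cycle g x"
    then obtain m where "m \<ge> k" "play g x m = v"
      by (auto simp: play_cycle_def INFM_nat_le)
    then show "v \<in> C" using stay[of "m - k"] by simp
  qed
  \<comment> \<open>Uniqueness depends on this: an empty \<open>play_cycle\<close> would be
    contained in every outcome. By the pigeonhole principle some position of the finite set
    \<open>C\<close> recurs infinitely often.\<close>
  moreover have "\<exists>v. v \<in> play_cycle g x"
  proof -
    have "finite ((\<lambda>m. play g x m) ` {k..})"
    proof (rule finite_subset[OF _ fin])
      show "(\<lambda>m. play g x m) ` {k..} \<subseteq> C"
        using stay by (metis atLeast_iff image_subsetI le_Suc_ex)
    qed
    then obtain m where "infinite {l \<in> {k..}. play g x l = play g x m}"
      using pigeonhole_infinite[OF infinite_Ici] by blast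
    then show ?thesis
      unfolding play_cycle_def INFM_iff_infinite
      by (auto intro!: exI[of _ "play g x m"] elim: contrapos_nn finite_subset[rotated])
  qed
  moreover have "D = C" if "D \<in> outcomes g" "v \<in> C" "v \<in> D" for D v
    using that C unfolding outcomes_def pre_digraph.sccs_verts_def by blast
  ultimately show ?thesis
    unfolding outcome_def using C by (intro the_equality) blast+
qed

text \<open>Any legal choice of moves \<open>h\<close> for one player is realised by a profile, and
  its whole effect is to override the successor map on that player's positions. Later arguments can
  therefore work with successor maps in place of profiles.\<close>

lemma deviation:
  assumes x: "x \<in> profiles g" and i: "i \<in> players g"
    and h: "\<And>v. v \<in> control g i \<Longrightarrow> (v, h v) \<in> parcs (game_graph g)"
  obtains x' where "x' \<in> profiles g" "\<And>j. j \<noteq> i \<Longrightarrow> x' j = x j"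
    "next_pos g x' = override_on (next_pos g x) h (control g i)"
proof
  let ?y = "\<lambda>v\<in>control g i. (v, h v)"
  let ?x = "x(i := ?y)"
  have "?y \<in> strategies g i"
    using h by (auto simp: strategies_def out_arcs_def)
  then show "?x \<in> profiles g"
    using x i by (auto simp: profiles_def PiE_def Pi_def extensional_def)
  \<comment> \<open>The two maps must agree at every \<open>v\<close>, even outside the graph, where
    \<open>controller\<close> is unspecified and may equal \<open>i\<close>. There the old and the
    new strategy both return \<open>undefined\<close>.\<close>
  have "x i v = undefined" if "v \<notin> control g i" for v
    using x i that by (auto simp: profiles_def strategies_def PiE_def extensional_def)
  then show "next_pos g ?x = override_on (next_pos g x) h (control g i)"
    using next_pos_control[OF i] by (auto simp: fun_eq_iff override_on_def next_pos_def)
qed simp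

end

section \<open>Components and outcomes of the three-person game\<close>

lemmas position_defs = s\<^sub>1_def u\<^sub>1_def v\<^sub>1_def u\<^sub>2_def v\<^sub>2_def u\<^sub>3_def v\<^sub>3_def a\<^sub>1_def a\<^sub>2_def
lemmas outcome_defs = A\<^sub>1_def A\<^sub>2_def C\<^sub>1_def C\<^sub>2_def C\<^sub>3_def

abbreviation "\<G> \<equiv> three_person_game"

text \<open>
  The reversed lists provide both orientations of each disequation as simplification rules.
\<close>

lemma positions_distinct:
  "distinct [s\<^sub>1, u\<^sub>1, v\<^sub>1, u\<^sub>2, v\<^sub>2, u\<^sub>3, v\<^sub>3, a\<^sub>1, a\<^sub>2]"
  "distinct [a\<^sub>2, a\<^sub>1, v\<^sub>3, u\<^sub>3, v\<^sub>2, u\<^sub>2, v\<^sub>1, u\<^sub>1, s\<^sub>1]"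
  by (simp_all add: position_defs)

lemma outcomes_distinct:
  "distinct [A\<^sub>1, A\<^sub>2, C\<^sub>1, C\<^sub>2, C\<^sub>3]" "distinct [C\<^sub>3, C\<^sub>2, C\<^sub>1, A\<^sub>2, A\<^sub>1]"
  by (simp_all add: outcome_defs position_defs doubleton_eq_iff)

lemmas position_neqs = positions_distinct[simplified]
lemmas outcome_neqs = outcomes_distinct[simplified]

lemma terminals_game: "terminals \<G> = {a\<^sub>1, a\<^sub>2}"
  by (auto simp: terminals_def out_arcs_def three_person_game_def position_defs)

lemma players_game: "players \<G> = {1, 2, 3}"
  by (auto simp: players_def three_person_game_def)

lemma looped_graph_game:
  "looped_graph \<G> = \<lparr>
     pverts = {s\<^sub>1, u\<^sub>1, v\<^sub>1, u\<^sub>2, v\<^sub>2, u\<^sub>3, v\<^sub>3, a\<^sub>1, a\<^sub>2},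
     parcs = {(a\<^sub>1, a\<^sub>1), (a\<^sub>2, a\<^sub>2),
              (s\<^sub>1, u\<^sub>2), (s\<^sub>1, v\<^sub>1), (s\<^sub>1, v\<^sub>2), (u\<^sub>1, u\<^sub>2), (u\<^sub>2, u\<^sub>1),
              (v\<^sub>1, u\<^sub>3), (u\<^sub>3, v\<^sub>1), (v\<^sub>2, v\<^sub>3), (v\<^sub>3, v\<^sub>2),
              (u\<^sub>1, v\<^sub>1), (v\<^sub>1, v\<^sub>2), (v\<^sub>2, a\<^sub>1), (u\<^sub>2, u\<^sub>3), (u\<^sub>3, v\<^sub>3), (v\<^sub>3, a\<^sub>2)}\<rparr>"
proof -
  have "{(v, v) |v. v \<in> terminals \<G>} = {(a\<^sub>1, a\<^sub>1), (a\<^sub>2, a\<^sub>2)}"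
    by (auto simp: terminals_game)
  \<comment> \<open>Moves the two loops to the front, which makes the arc set literally the one in
    the statement.\<close>
  moreover have "A \<union> {p, q} = insert p (insert q A)" for A and p q :: "nat \<times> nat"
    by auto
  ultimately show ?thesis by (simp add: looped_graph_def three_person_game_def)
qed

text \<open>Constant on the components and nondecreasing along arcs.\<close>

definition level :: "nat \<Rightarrow> nat" where
  "level v = (if v = s\<^sub>1 then 0 else if v \<in> C\<^sub>1 then 1 else if v \<in> C\<^sub>2 then 2
     else if v \<in> C\<^sub>3 then 3 else if v = a\<^sub>1 then 4 else 5)"

lemma sccs_game:
  "pre_digraph.sccs_verts (with_proj (looped_graph \<G>)) = {{s\<^sub>1}, A\<^sub>1, A\<^sub>2, C\<^sub>1, C\<^sub>2, C\<^sub>3}"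
proof -
  let ?V = "{s\<^sub>1, u\<^sub>1, v\<^sub>1, u\<^sub>2, v\<^sub>2, u\<^sub>3, v\<^sub>3, a\<^sub>1, a\<^sub>2}"
  have V: "verts (with_proj (looped_graph \<G>)) = ?V"
    by (simp add: looped_graph_game)
  have "pre_digraph.sccs_verts (with_proj (looped_graph \<G>)) =
    (\<lambda>u. {v \<in> ?V. level v = level u}) ` ?V"
    unfolding V[symmetric]
  proof (rule sccs_verts_eq_level_sets)
    fix u v assume "u \<rightarrow>\<^bsub>with_proj (looped_graph \<G>)\<^esub> v"
    then show "level u \<le> level v"
      by (auto simp: looped_graph_game level_def outcome_defs position_defs)
  next
    fix u v assume uv: "u \<in> verts (with_proj (looped_graph \<G>))"
      "v \<in> verts (with_proj (looped_graph \<G>))" "level u = level v"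
    \<comment> \<open>Each component has at most two vertices, and a pair is joined by arcs in both
      directions, so one arc is enough.\<close>
    then have "u = v \<or> (u, v) \<in> parcs (looped_graph \<G>)"
      unfolding V by (elim insertE emptyE)
        (simp_all add: looped_graph_game level_def outcome_defs position_defs)
    then show "u \<rightarrow>\<^sup>*\<^bsub>with_proj (looped_graph \<G>)\<^esub> v"
      using uv rtrancl_on_into_rtrancl_on[of u u] by (auto simp: reachable_def)
  qed
  also have "\<dots> = {{s\<^sub>1}, A\<^sub>1, A\<^sub>2, C\<^sub>1, C\<^sub>2, C\<^sub>3}"
  proof -
    \<comment> \<open>\<open>level\<close> is 5 on every number that is not a position, so the last
      set equals \<open>A\<^sub>2\<close> only because of the restriction to
      \<open>?V\<close>.\<close>
    have sets: "{v \<in> ?V. level v = 0} = {s\<^sub>1}" "{v \<in> ?V. level v = 1} = C\<^sub>1"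
      "{v \<in> ?V. level v = 2} = C\<^sub>2" "{v \<in> ?V. level v = 3} = C\<^sub>3"
      "{v \<in> ?V. level v = 4} = A\<^sub>1" "{v \<in> ?V. level v = 5} = A\<^sub>2"
      by (auto simp: level_def outcome_defs position_defs split: if_splits)
    have levels: "level s\<^sub>1 = 0" "level u\<^sub>1 = 1" "level u\<^sub>2 = 1" "level v\<^sub>1 = 2" "level u\<^sub>3 = 2"
      "level v\<^sub>2 = 3" "level v\<^sub>3 = 3" "level a\<^sub>1 = 4" "level a\<^sub>2 = 5"
      by (simp_all add: level_def outcome_defs position_defs)
    show ?thesis
      unfolding image_insert image_empty levels sets by auto
  qed
  finally show ?thesis .
qed

lemma outcomes_game: "outcomes \<G> = {A\<^sub>1, A\<^sub>2, C\<^sub>1, C\<^sub>2, C\<^sub>3}"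
proof -
  let ?cyc = "\<lambda>C p. pre_digraph.cycle (with_proj (looped_graph \<G>) \<restriction> C) p"
  note cycle_simps = pre_digraph.cycle_def pre_digraph.awalk_def pre_digraph.cas.simps
    pre_digraph.awalk_verts.simps looped_graph_game outcome_defs position_defs
  \<comment> \<open>A cycle is nonempty, and its first arc inside \<open>{s\<^sub>1}\<close> would
    have to be a loop at \<open>s\<^sub>1\<close>; this component is transient.\<close>
  have "\<not> ?cyc {s\<^sub>1} p" for p
  proof (cases p)
    case (Cons e es)
    then show ?thesis by (cases e) (auto simp: cycle_simps)
  qed (simp add: pre_digraph.cycle_def)
  moreover have "?cyc A\<^sub>1 [(a\<^sub>1, a\<^sub>1)]" "?cyc A\<^sub>2 [(a\<^sub>2, a\<^sub>2)]" "?cyc C\<^sub>1 [(u\<^sub>1, u\<^sub>2), (u\<^sub>2, u\<^sub>1)]"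
    "?cyc C\<^sub>2 [(v\<^sub>1, u\<^sub>3), (u\<^sub>3, v\<^sub>1)]" "?cyc C\<^sub>3 [(v\<^sub>2, v\<^sub>3), (v\<^sub>3, v\<^sub>2)]"
    by (auto simp: cycle_simps)
  ultimately show ?thesis
    unfolding outcomes_def sccs_game by blast
qed

lemma terminal_outcomes_game: "terminal_outcomes \<G> = {A\<^sub>1, A\<^sub>2}"
proof -
  let ?leaves = "\<lambda>C. \<exists>(u, v) \<in> parcs (looped_graph \<G>). u \<in> C \<and> v \<notin> C"
  have "?leaves C\<^sub>1" "?leaves C\<^sub>2" "?leaves C\<^sub>3" "\<not> ?leaves A\<^sub>1" "\<not> ?leaves A\<^sub>2"
    by (auto simp: looped_graph_game outcome_defs position_defs)
  then show ?thesis
    unfolding terminal_outcomes_def outcomes_game by blast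
qed

lemma cyclic_outcomes_game: "cyclic_outcomes \<G> = {C\<^sub>1, C\<^sub>2, C\<^sub>3}"
  by (auto simp: cyclic_outcomes_def outcomes_game terminal_outcomes_game outcome_neqs)

section \<open>Preference orders and ranks\<close>

text \<open>In a distinct list an element determines its index, so the relation is a copy of
  \<open><\<close> on the indices.\<close>

lemma strict_linear_order_chain_order:
  assumes "distinct xs"
  shows "strict_linear_order_on (set xs) (chain_order xs)"
  unfolding strict_linear_order_on_def
proof (intro conjI)
  show "trans (chain_order xs)"
    using assms by (fastforce simp: chain_order_def nth_eq_iff_index_eq intro!: transI)
  show "irrefl (chain_order xs)"
    using assms by (auto simp: chain_order_def irrefl_def nth_eq_iff_index_eq)
  show "total_on (set xs) (chain_order xs)"
    by (auto simp: chain_order_def total_on_def in_set_conv_nth) (metis linorder_neqE_nat)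
qed

lemma chain_order_subset: "chain_order xs \<subseteq> set xs \<times> set xs"
  by (auto simp: chain_order_def)

lemma chain_order_Nil: "chain_order [] = {}"
  by (auto simp: chain_order_def)

text \<open>Lets the simplifier decide comparisons in a concrete list without reasoning about
  indices.\<close>

lemma chain_order_Cons: "chain_order (x # xs) = {x} \<times> set xs \<union> chain_order xs"
proof -
  have "(a, b) \<in> chain_order (x # xs) \<longleftrightarrow> a = x \<and> b \<in> set xs \<or> (a, b) \<in> chain_order xs" for a b
  proof -
    \<comment> \<open>With the larger index quantified first and both ranges bounded,
      \<open>Ex_less_Suc2\<close> can split off index 0 for \<open>k\<close> and then for
      \<open>j\<close>.\<close>
    have "(a, b) \<in> chain_order (x # xs) \<longleftrightarrow>
      (\<exists>k<Suc (length xs). \<exists>j<k. a = (x # xs) ! j \<and> b = (x # xs) ! k)"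
      by (auto simp: chain_order_def)
    also have "\<dots> \<longleftrightarrow> (\<exists>k<length xs. (a = x \<or> (\<exists>j<k. a = xs ! j)) \<and> b = xs ! k)"
      by (auto simp: Ex_less_Suc2)
    finally show ?thesis by (auto simp: chain_order_def in_set_conv_nth)
  qed
  then show ?thesis by auto
qed

lemma pref_game:
  "pref \<G> 1 = chain_order [C\<^sub>1, A\<^sub>1, C\<^sub>2, C\<^sub>3, A\<^sub>2]"
  "pref \<G> 2 = chain_order [A\<^sub>2, C\<^sub>1, C\<^sub>2, A\<^sub>1, C\<^sub>3]"
  "pref \<G> 3 = chain_order [C\<^sub>3, C\<^sub>1, A\<^sub>2, C\<^sub>2, A\<^sub>1]"
  by (simp_all add: three_person_game_def)

lemma finite_dg_game_game: "finite_dg_game \<G>"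
proof (rule finite_dg_game.intro)
  show "pair_fin_digraph (game_graph \<G>)"
    by unfold_locales (auto simp: three_person_game_def)
  show "init_pos \<G> \<in> pverts (game_graph \<G>) - terminals \<G>"
    unfolding terminals_game by (simp add: three_person_game_def position_defs)
  show "(\<Union>i\<in>players \<G>. control \<G> i) \<union> terminals \<G> = pverts (game_graph \<G>)"
    unfolding terminals_game players_game by (auto simp: three_person_game_def)
  show "disjoint_family_on (control \<G>) (players \<G>)"
    unfolding players_game
    by (simp add: disjoint_family_on_def three_person_game_def position_defs)
  fix i assume i: "i \<in> players \<G>"
  then show "control \<G> i \<inter> terminals \<G> = {}"
    unfolding terminals_game players_game by (auto simp: three_person_game_def position_defs)
  have order: "pref \<G> i \<subseteq> outcomes \<G> \<times> outcomes \<G> \<and> strict_linear_order_on (outcomes \<G>) (pref \<G> i)"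
    if "pref \<G> i = chain_order xs" "outcomes \<G> = set xs" "distinct xs" for xs
    unfolding that(1,2)
    using chain_order_subset[of xs] strict_linear_order_chain_order[OF that(3)] by blast
  consider "i = 1" | "i = 2" | "i = 3" using i unfolding players_game by blast
  then have "pref \<G> i \<subseteq> outcomes \<G> \<times> outcomes \<G> \<and>
    strict_linear_order_on (outcomes \<G>) (pref \<G> i)"
  proof cases
    case 1
    show ?thesis by (rule order[OF pref_game(1)[folded 1]]) (auto simp: outcomes_game outcome_neqs)
  next
    case 2
    show ?thesis by (rule order[OF pref_game(2)[folded 2]]) (auto simp: outcomes_game outcome_neqs)
  next
    case 3
    show ?thesis by (rule order[OF pref_game(3)[folded 3]]) (auto simp: outcomes_game outcome_neqs)
  qed
  then show "pref \<G> i \<subseteq> outcomes \<G> \<times> outcomes \<G>"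
    and "strict_linear_order_on (outcomes \<G>) (pref \<G> i)"
    by simp_all
qed

text \<open>\<open>A\<^sub>2\<close> is the best outcome of player 1 and \<open>A\<^sub>1\<close>
  that of player 3, so neither is counted for that player, while \<open>C\<^sub>2\<close> beats the
  other terminal outcome. Player 2 likes \<open>C\<^sub>3\<close> best, so both terminal outcomes
  count.\<close>

lemma rank_game: "rank \<G> 1 = 1" "rank \<G> 2 = 2" "rank \<G> 3 = 1"
proof -
  have prefers_cyclic: "\<exists>c \<in> {C\<^sub>1, C\<^sub>2, C\<^sub>3}. (A\<^sub>1, c) \<in> pref \<G> 1"
    "\<not> (\<exists>c \<in> {C\<^sub>1, C\<^sub>2, C\<^sub>3}. (A\<^sub>2, c) \<in> pref \<G> 1)"
    "\<exists>c \<in> {C\<^sub>1, C\<^sub>2, C\<^sub>3}. (A\<^sub>1, c) \<in> pref \<G> 2"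
    "\<exists>c \<in> {C\<^sub>1, C\<^sub>2, C\<^sub>3}. (A\<^sub>2, c) \<in> pref \<G> 2"
    "\<not> (\<exists>c \<in> {C\<^sub>1, C\<^sub>2, C\<^sub>3}. (A\<^sub>1, c) \<in> pref \<G> 3)"
    "\<exists>c \<in> {C\<^sub>1, C\<^sub>2, C\<^sub>3}. (A\<^sub>2, c) \<in> pref \<G> 3"
    unfolding pref_game by (simp_all add: chain_order_Cons chain_order_Nil outcome_neqs)
  have sets: "{a \<in> {A\<^sub>1, A\<^sub>2}. \<exists>c \<in> {C\<^sub>1, C\<^sub>2, C\<^sub>3}. (a, c) \<in> pref \<G> 1} = {A\<^sub>1}"
    "{a \<in> {A\<^sub>1, A\<^sub>2}. \<exists>c \<in> {C\<^sub>1, C\<^sub>2, C\<^sub>3}. (a, c) \<in> pref \<G> 2} = {A\<^sub>1, A\<^sub>2}"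
    "{a \<in> {A\<^sub>1, A\<^sub>2}. \<exists>c \<in> {C\<^sub>1, C\<^sub>2, C\<^sub>3}. (a, c) \<in> pref \<G> 3} = {A\<^sub>2}"
    using prefers_cyclic by blast+
  have "rank \<G> 1 = card {A\<^sub>1}" "rank \<G> 2 = card {A\<^sub>1, A\<^sub>2}" "rank \<G> 3 = card {A\<^sub>2}"
    by (simp_all only: rank_def terminal_outcomes_game cyclic_outcomes_game sets)
  then show "rank \<G> 1 = 1" "rank \<G> 2 = 2" "rank \<G> 3 = 1"
    by (simp_all add: outcome_neqs)
qed

lemma rank_vector_game: "rank_vector \<G> = [1, 2, 1]"
proof -
  have "[1..<Suc (num_players \<G>)] = [1, 2, 3]"
    by (simp add: three_person_game_def upt_rec)
  then show ?thesis using rank_game by (simp add: rank_vector_def)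
qed

section \<open>The outcome as a function of the seven chosen moves\<close>

text \<open>What \<open>outcome_eqI\<close> asks of a component, stated for an arbitrary map and
  starting point so that it can be propagated backwards along single moves.\<close>

definition leads :: "('a \<Rightarrow> 'a) \<Rightarrow> 'a \<Rightarrow> 'a set \<Rightarrow> bool" where
  "leads f v C \<longleftrightarrow> (\<exists>k. (f ^^ k) v \<in> C) \<and> f ` C \<subseteq> C"

lemma leads_refl: "v \<in> C \<Longrightarrow> f ` C \<subseteq> C \<Longrightarrow> leads f v C"
  unfolding leads_def by (metis funpow_0)

lemma leads_step: "f v = w \<Longrightarrow> leads f w C \<Longrightarrow> leads f v C"
  unfolding leads_def by (metis comp_apply funpow_Suc_right)

text \<open>
  Each \<open>fate\<close> is the component in which the play from the given position ends;
  without an index the position is \<open>s\<^sub>1\<close>.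
  The move chosen in \<open>s\<^sub>1\<close> is called \<open>s\<close>, those in \<open>u\<^sub>i\<close> and \<open>v\<^sub>i\<close> are called \<open>p\<^sub>i\<close> and \<open>q\<^sub>i\<close>.
\<close>

definition fate_v2 :: "nat \<Rightarrow> nat \<Rightarrow> nat set" where
  "fate_v2 q\<^sub>2 q\<^sub>3 = (if q\<^sub>2 = a\<^sub>1 then A\<^sub>1 else if q\<^sub>3 = v\<^sub>2 then C\<^sub>3 else A\<^sub>2)"

definition fate_v3 :: "nat \<Rightarrow> nat \<Rightarrow> nat set" where
  "fate_v3 q\<^sub>2 q\<^sub>3 = (if q\<^sub>3 = a\<^sub>2 then A\<^sub>2 else if q\<^sub>2 = v\<^sub>3 then C\<^sub>3 else A\<^sub>1)"

definition fate_v1 :: "nat \<Rightarrow> nat \<Rightarrow> nat \<Rightarrow> nat \<Rightarrow> nat set" where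
  "fate_v1 q\<^sub>1 q\<^sub>2 p\<^sub>3 q\<^sub>3 =
     (if q\<^sub>1 = v\<^sub>2 then fate_v2 q\<^sub>2 q\<^sub>3 else if p\<^sub>3 = v\<^sub>1 then C\<^sub>2 else fate_v3 q\<^sub>2 q\<^sub>3)"

definition fate_u3 :: "nat \<Rightarrow> nat \<Rightarrow> nat \<Rightarrow> nat \<Rightarrow> nat set" where
  "fate_u3 q\<^sub>1 q\<^sub>2 p\<^sub>3 q\<^sub>3 =
     (if p\<^sub>3 = v\<^sub>3 then fate_v3 q\<^sub>2 q\<^sub>3 else if q\<^sub>1 = u\<^sub>3 then C\<^sub>2 else fate_v2 q\<^sub>2 q\<^sub>3)"

definition fate_u2 :: "nat \<Rightarrow> nat \<Rightarrow> nat \<Rightarrow> nat \<Rightarrow> nat \<Rightarrow> nat \<Rightarrow> nat set" where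
  "fate_u2 p\<^sub>1 q\<^sub>1 p\<^sub>2 q\<^sub>2 p\<^sub>3 q\<^sub>3 =
     (if p\<^sub>2 = u\<^sub>3 then fate_u3 q\<^sub>1 q\<^sub>2 p\<^sub>3 q\<^sub>3 else if p\<^sub>1 = u\<^sub>2 then C\<^sub>1 else fate_v1 q\<^sub>1 q\<^sub>2 p\<^sub>3 q\<^sub>3)"

definition fate :: "nat \<Rightarrow> nat \<Rightarrow> nat \<Rightarrow> nat \<Rightarrow> nat \<Rightarrow> nat \<Rightarrow> nat \<Rightarrow> nat set" where
  "fate s p\<^sub>1 q\<^sub>1 p\<^sub>2 q\<^sub>2 p\<^sub>3 q\<^sub>3 =
     (if s = v\<^sub>2 then fate_v2 q\<^sub>2 q\<^sub>3 else if s = v\<^sub>1 then fate_v1 q\<^sub>1 q\<^sub>2 p\<^sub>3 q\<^sub>3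
      else fate_u2 p\<^sub>1 q\<^sub>1 p\<^sub>2 q\<^sub>2 p\<^sub>3 q\<^sub>3)"

lemmas fate_defs = fate_v2_def fate_v3_def fate_v1_def fate_u3_def fate_u2_def fate_def

lemma fate_in_outcomes: "fate s p\<^sub>1 q\<^sub>1 p\<^sub>2 q\<^sub>2 p\<^sub>3 q\<^sub>3 \<in> outcomes \<G>"
proof -
  have "fate_v2 q\<^sub>2 q\<^sub>3 \<in> outcomes \<G>" "fate_v3 q\<^sub>2 q\<^sub>3 \<in> outcomes \<G>"
    by (simp_all add: fate_v2_def fate_v3_def outcomes_game)
  moreover from this have "fate_v1 q\<^sub>1 q\<^sub>2 p\<^sub>3 q\<^sub>3 \<in> outcomes \<G>" "fate_u3 q\<^sub>1 q\<^sub>2 p\<^sub>3 q\<^sub>3 \<in> outcomes \<G>"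
    \<comment> \<open>\<open>outcomes \<G>\<close> stays folded at first so that the facts just
      proved apply; only the membership of \<open>C\<^sub>2\<close> is left for the second
      call.\<close>
    by (simp_all add: fate_v1_def fate_u3_def) (simp_all add: outcomes_game)
  moreover from this have "fate_u2 p\<^sub>1 q\<^sub>1 p\<^sub>2 q\<^sub>2 p\<^sub>3 q\<^sub>3 \<in> outcomes \<G>"
    by (simp add: fate_u2_def) (simp add: outcomes_game)
  ultimately show ?thesis by (simp add: fate_def)
qed

text \<open>Backward induction over the components: in each pair the play either alternates between
  the two positions forever or leaves within two moves for a position whose fate is already
  known.\<close>

lemma leads_fate:
  assumes "f a\<^sub>1 = a\<^sub>1" "f a\<^sub>2 = a\<^sub>2" "f s\<^sub>1 \<in> {u\<^sub>2, v\<^sub>1, v\<^sub>2}" "f u\<^sub>1 \<in> {u\<^sub>2, v\<^sub>1}" "f v\<^sub>1 \<in> {u\<^sub>3, v\<^sub>2}"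
    "f u\<^sub>2 \<in> {u\<^sub>1, u\<^sub>3}" "f v\<^sub>2 \<in> {v\<^sub>3, a\<^sub>1}" "f u\<^sub>3 \<in> {v\<^sub>1, v\<^sub>3}" "f v\<^sub>3 \<in> {v\<^sub>2, a\<^sub>2}"
  shows "leads f s\<^sub>1 (fate (f s\<^sub>1) (f u\<^sub>1) (f v\<^sub>1) (f u\<^sub>2) (f v\<^sub>2) (f u\<^sub>3) (f v\<^sub>3))"
proof -
  have A: "leads f a\<^sub>1 A\<^sub>1" "leads f a\<^sub>2 A\<^sub>2"
    using assms by (auto simp: A\<^sub>1_def A\<^sub>2_def intro: leads_refl)
  have C3: "leads f v\<^sub>2 C\<^sub>3" "leads f v\<^sub>3 C\<^sub>3" if "f v\<^sub>2 = v\<^sub>3" "f v\<^sub>3 = v\<^sub>2"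
    using that by (auto simp: C\<^sub>3_def intro: leads_refl)
  have C2: "leads f v\<^sub>1 C\<^sub>2" "leads f u\<^sub>3 C\<^sub>2" if "f v\<^sub>1 = u\<^sub>3" "f u\<^sub>3 = v\<^sub>1"
    using that by (auto simp: C\<^sub>2_def intro: leads_refl)
  \<comment> \<open>Only \<open>u\<^sub>2\<close> is treated, since the sole arc entering this
    component from outside is the one from \<open>s\<^sub>1\<close> to
    \<open>u\<^sub>2\<close>.\<close>
  have C1: "leads f u\<^sub>2 C\<^sub>1" if "f u\<^sub>1 = u\<^sub>2" "f u\<^sub>2 = u\<^sub>1"
    using that by (auto simp: C\<^sub>1_def intro: leads_refl)
  note to_terminal = A[THEN leads_step[rotated]]
  have v2: "leads f v\<^sub>2 (fate_v2 (f v\<^sub>2) (f v\<^sub>3))" and v3: "leads f v\<^sub>3 (fate_v3 (f v\<^sub>2) (f v\<^sub>3))"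
    using assms(7,9) unfolding fate_v2_def fate_v3_def
    by (auto simp: to_terminal leads_step[OF _ to_terminal(1)] leads_step[OF _ to_terminal(2)] C3
        position_neqs)
  have v1: "leads f v\<^sub>1 (fate_v1 (f v\<^sub>1) (f v\<^sub>2) (f u\<^sub>3) (f v\<^sub>3))"
    and u3: "leads f u\<^sub>3 (fate_u3 (f v\<^sub>1) (f v\<^sub>2) (f u\<^sub>3) (f v\<^sub>3))"
    using assms(5,8) unfolding fate_v1_def fate_u3_def
    by (auto simp: leads_step[OF _ v2] leads_step[OF _ v3] leads_step[OF _ leads_step[OF _ v2]]
        leads_step[OF _ leads_step[OF _ v3]] C2 position_neqs)
  have u2: "leads f u\<^sub>2 (fate_u2 (f u\<^sub>1) (f v\<^sub>1) (f u\<^sub>2) (f v\<^sub>2) (f u\<^sub>3) (f v\<^sub>3))"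
    using assms(4,6) unfolding fate_u2_def
    by (auto simp: leads_step[OF _ u3] leads_step[OF _ leads_step[OF _ v1]] C1 position_neqs)
  show ?thesis
    using assms(3) unfolding fate_def
    by (auto simp: leads_step[OF _ v2] leads_step[OF _ v1] leads_step[OF _ u2])
qed

text \<open>The facts follow the order of the hypotheses of \<open>leads_fate\<close>; the last
  seven are also those of \<open>profitable_deviation\<close>.\<close>

lemma next_pos_game:
  assumes x: "x \<in> profiles \<G>"
  defines "f \<equiv> next_pos \<G> x"
  shows "f a\<^sub>1 = a\<^sub>1" "f a\<^sub>2 = a\<^sub>2" "f s\<^sub>1 \<in> {u\<^sub>2, v\<^sub>1, v\<^sub>2}" "f u\<^sub>1 \<in> {u\<^sub>2, v\<^sub>1}" "f v\<^sub>1 \<in> {u\<^sub>3, v\<^sub>2}"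
    "f u\<^sub>2 \<in> {u\<^sub>1, u\<^sub>3}" "f v\<^sub>2 \<in> {v\<^sub>3, a\<^sub>1}" "f u\<^sub>3 \<in> {v\<^sub>1, v\<^sub>3}" "f v\<^sub>3 \<in> {v\<^sub>2, a\<^sub>2}"
proof -
  show "f a\<^sub>1 = a\<^sub>1" "f a\<^sub>2 = a\<^sub>2"
    by (simp_all add: f_def next_pos_def terminals_game)
  have arc: "(v, f v) \<in> parcs (game_graph \<G>)" if "i \<in> {1, 2, 3}" "v \<in> control \<G> i" for i v
    using that finite_dg_game.next_pos_arc[OF finite_dg_game_game x] by (simp add: players_game f_def)
  show "f s\<^sub>1 \<in> {u\<^sub>2, v\<^sub>1, v\<^sub>2}" "f u\<^sub>1 \<in> {u\<^sub>2, v\<^sub>1}" "f v\<^sub>1 \<in> {u\<^sub>3, v\<^sub>2}"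
    using arc[of 1 s\<^sub>1] arc[of 1 u\<^sub>1] arc[of 1 v\<^sub>1]
    by (auto simp: three_person_game_def position_defs)
  show "f u\<^sub>2 \<in> {u\<^sub>1, u\<^sub>3}" "f v\<^sub>2 \<in> {v\<^sub>3, a\<^sub>1}"
    using arc[of 2 u\<^sub>2] arc[of 2 v\<^sub>2] by (auto simp: three_person_game_def position_defs)
  show "f u\<^sub>3 \<in> {v\<^sub>1, v\<^sub>3}" "f v\<^sub>3 \<in> {v\<^sub>2, a\<^sub>2}"
    using arc[of 3 u\<^sub>3] arc[of 3 v\<^sub>3] by (auto simp: three_person_game_def position_defs)
qed

text \<open>Combines \<open>leads_fate\<close> with \<open>outcome_eqI\<close>. From here on
  infinite plays are replaced by a finite case distinction on moves.\<close>

lemma outcome_game: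
  assumes x: "x \<in> profiles \<G>"
  defines "f \<equiv> next_pos \<G> x"
  shows "outcome \<G> x = fate (f s\<^sub>1) (f u\<^sub>1) (f v\<^sub>1) (f u\<^sub>2) (f v\<^sub>2) (f u\<^sub>3) (f v\<^sub>3)"
proof -
  let ?C = "fate (f s\<^sub>1) (f u\<^sub>1) (f v\<^sub>1) (f u\<^sub>2) (f v\<^sub>2) (f u\<^sub>3) (f v\<^sub>3)"
  have "leads f s\<^sub>1 ?C"
    unfolding f_def by (intro leads_fate next_pos_game x)
  moreover have "?C \<in> outcomes \<G>"
    by (rule fate_in_outcomes)
  moreover have "init_pos \<G> = s\<^sub>1" by (simp add: three_person_game_def)
  ultimately show ?thesis
    unfolding leads_def f_def by (metis finite_dg_game.outcome_eqI[OF finite_dg_game_game])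
qed

text \<open>The six deviations come from an exhaustive search; no five fixed ones suffice.\<close>

lemma profitable_deviation:
  assumes "s \<in> {u\<^sub>2, v\<^sub>1, v\<^sub>2}" "p\<^sub>1 \<in> {u\<^sub>2, v\<^sub>1}" "q\<^sub>1 \<in> {u\<^sub>3, v\<^sub>2}"
    "p\<^sub>2 \<in> {u\<^sub>1, u\<^sub>3}" "q\<^sub>2 \<in> {v\<^sub>3, a\<^sub>1}" "p\<^sub>3 \<in> {v\<^sub>1, v\<^sub>3}" "q\<^sub>3 \<in> {v\<^sub>2, a\<^sub>2}"
  defines "C \<equiv> fate s p\<^sub>1 q\<^sub>1 p\<^sub>2 q\<^sub>2 p\<^sub>3 q\<^sub>3"
  shows "(C, fate u\<^sub>2 v\<^sub>1 u\<^sub>3 p\<^sub>2 q\<^sub>2 p\<^sub>3 q\<^sub>3) \<in> pref \<G> 1 \<or> (C, fate v\<^sub>2 v\<^sub>1 u\<^sub>3 p\<^sub>2 q\<^sub>2 p\<^sub>3 q\<^sub>3) \<in> pref \<G> 1 \<or>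
    (C, fate s p\<^sub>1 q\<^sub>1 u\<^sub>1 a\<^sub>1 p\<^sub>3 q\<^sub>3) \<in> pref \<G> 2 \<or> (C, fate s p\<^sub>1 q\<^sub>1 u\<^sub>3 v\<^sub>3 p\<^sub>3 q\<^sub>3) \<in> pref \<G> 2 \<or>
    (C, fate s p\<^sub>1 q\<^sub>1 p\<^sub>2 q\<^sub>2 v\<^sub>1 a\<^sub>2) \<in> pref \<G> 3 \<or> (C, fate s p\<^sub>1 q\<^sub>1 p\<^sub>2 q\<^sub>2 v\<^sub>3 v\<^sub>2) \<in> pref \<G> 3"
proof -
  \<comment> \<open>Under these names the ten strict comparisons of each player serve as rewrite
    rules to \<open>True\<close>. Listing the valid ones is enough, because a single true disjunct
    settles a case.\<close>
  define P1 P2 P3 where P: "P1 = pref \<G> 1" "P2 = pref \<G> 2" "P3 = pref \<G> 3"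
  have P1: "(C\<^sub>1, A\<^sub>1) \<in> P1" "(C\<^sub>1, C\<^sub>2) \<in> P1" "(C\<^sub>1, C\<^sub>3) \<in> P1" "(C\<^sub>1, A\<^sub>2) \<in> P1" "(A\<^sub>1, C\<^sub>2) \<in> P1"
    "(A\<^sub>1, C\<^sub>3) \<in> P1" "(A\<^sub>1, A\<^sub>2) \<in> P1" "(C\<^sub>2, C\<^sub>3) \<in> P1" "(C\<^sub>2, A\<^sub>2) \<in> P1" "(C\<^sub>3, A\<^sub>2) \<in> P1"
    and P2: "(A\<^sub>2, C\<^sub>1) \<in> P2" "(A\<^sub>2, C\<^sub>2) \<in> P2" "(A\<^sub>2, A\<^sub>1) \<in> P2" "(A\<^sub>2, C\<^sub>3) \<in> P2" "(C\<^sub>1, C\<^sub>2) \<in> P2"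
    "(C\<^sub>1, A\<^sub>1) \<in> P2" "(C\<^sub>1, C\<^sub>3) \<in> P2" "(C\<^sub>2, A\<^sub>1) \<in> P2" "(C\<^sub>2, C\<^sub>3) \<in> P2" "(A\<^sub>1, C\<^sub>3) \<in> P2"
    and P3: "(C\<^sub>3, C\<^sub>1) \<in> P3" "(C\<^sub>3, A\<^sub>2) \<in> P3" "(C\<^sub>3, C\<^sub>2) \<in> P3" "(C\<^sub>3, A\<^sub>1) \<in> P3" "(C\<^sub>1, A\<^sub>2) \<in> P3"
    "(C\<^sub>1, C\<^sub>2) \<in> P3" "(C\<^sub>1, A\<^sub>1) \<in> P3" "(A\<^sub>2, C\<^sub>2) \<in> P3" "(A\<^sub>2, A\<^sub>1) \<in> P3" "(C\<^sub>2, A\<^sub>1) \<in> P3"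
    unfolding P pref_game chain_order_Cons by simp_all
  show ?thesis
    using assms(1-7) unfolding C_def P[symmetric]
    \<comment> \<open>Splitting the seven memberships gives the 192 profiles, and each disjunction
      is then evaluated by rewriting.\<close>
    by (elim insertE emptyE; hypsubst; simp only: fate_defs position_neqs P1 P2 P3 if_True if_False simp_thms)
qed

section \<open>Absence of equilibria\<close>

text \<open>At an equilibrium every deviation fails to improve, which refutes all six disjuncts of
  \<open>profitable_deviation\<close>.\<close>

lemma no_nash_equilibrium_game: "\<not> nash_equilibrium \<G> x"
proof
  assume nash: "nash_equilibrium \<G> x"
  then have x: "x \<in> profiles \<G>" by (simp add: nash_equilibrium_def)
  let ?f = "next_pos \<G> x"
  let ?fate = "\<lambda>f. fate (f s\<^sub>1) (f u\<^sub>1) (f v\<^sub>1) (f u\<^sub>2) (f v\<^sub>2) (f u\<^sub>3) (f v\<^sub>3)"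
  have dev: "(?fate ?f, ?fate (override_on ?f h (control \<G> i))) \<notin> pref \<G> i"
    if "i \<in> {1, 2, 3}" and h: "\<And>v. v \<in> control \<G> i \<Longrightarrow> (v, h v) \<in> parcs (game_graph \<G>)" for i h
  proof -
    have i: "i \<in> players \<G>" using that(1) by (simp add: players_game)
    obtain x' where x': "x' \<in> profiles \<G>" "\<And>j. j \<noteq> i \<Longrightarrow> x' j = x j"
      and eq: "next_pos \<G> x' = override_on ?f h (control \<G> i)"
      using finite_dg_game.deviation[OF finite_dg_game_game x i h] by blast
    have "(outcome \<G> x, outcome \<G> x') \<notin> pref \<G> i"
      using nash x' i unfolding nash_equilibrium_def by blast
    then show ?thesis
      unfolding outcome_game[OF x] outcome_game[OF x'(1)] eq .
  qed
  have dev1: "(?fate ?f, fate s p q (?f u\<^sub>2) (?f v\<^sub>2) (?f u\<^sub>3) (?f v\<^sub>3)) \<notin> pref \<G> 1"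
    if m: "s \<in> {u\<^sub>2, v\<^sub>1, v\<^sub>2}" "p \<in> {u\<^sub>2, v\<^sub>1}" "q \<in> {u\<^sub>3, v\<^sub>2}" for s p q
  proof -
    \<comment> \<open>The final \<open>else\<close> stands for \<open>v\<^sub>1\<close>, because the
      override consults \<open>?h\<close> only at positions of player 1.\<close>
    let ?h = "\<lambda>v. if v = s\<^sub>1 then s else if v = u\<^sub>1 then p else q"
    have c: "control \<G> 1 = {s\<^sub>1, u\<^sub>1, v\<^sub>1}" by (simp add: three_person_game_def)
    have "(v, ?h v) \<in> parcs (game_graph \<G>)" if "v \<in> {s\<^sub>1, u\<^sub>1, v\<^sub>1}" for v
      using m that by (auto simp: three_person_game_def position_neqs)
    from dev[of 1 ?h, unfolded c, OF _ this] show ?thesis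
      by (simp add: override_on_def position_neqs)
  qed
  have dev2: "(?fate ?f, fate (?f s\<^sub>1) (?f u\<^sub>1) (?f v\<^sub>1) p q (?f u\<^sub>3) (?f v\<^sub>3)) \<notin> pref \<G> 2"
    if m: "p \<in> {u\<^sub>1, u\<^sub>3}" "q \<in> {v\<^sub>3, a\<^sub>1}" for p q
  proof -
    let ?h = "\<lambda>v. if v = u\<^sub>2 then p else q"
    have c: "control \<G> 2 = {u\<^sub>2, v\<^sub>2}" by (simp add: three_person_game_def)
    have "(v, ?h v) \<in> parcs (game_graph \<G>)" if "v \<in> {u\<^sub>2, v\<^sub>2}" for v
      using m that by (auto simp: three_person_game_def position_neqs)
    from dev[of 2 ?h, unfolded c, OF _ this] show ?thesis
      by (simp add: override_on_def position_neqs)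
  qed
  have dev3: "(?fate ?f, fate (?f s\<^sub>1) (?f u\<^sub>1) (?f v\<^sub>1) (?f u\<^sub>2) (?f v\<^sub>2) p q) \<notin> pref \<G> 3"
    if m: "p \<in> {v\<^sub>1, v\<^sub>3}" "q \<in> {v\<^sub>2, a\<^sub>2}" for p q
  proof -
    let ?h = "\<lambda>v. if v = u\<^sub>3 then p else q"
    have c: "control \<G> 3 = {u\<^sub>3, v\<^sub>3}" by (simp add: three_person_game_def)
    have "(v, ?h v) \<in> parcs (game_graph \<G>)" if "v \<in> {u\<^sub>3, v\<^sub>3}" for v
      using m that by (auto simp: three_person_game_def position_neqs)
    from dev[of 3 ?h, unfolded c, OF _ this] show ?thesis
      by (simp add: override_on_def position_neqs)
  qed
  show False
    using profitable_deviation[OF next_pos_game(3-9)[OF x]]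
    \<comment> \<open>Each disjunct contradicts the fact for the player it concerns;
      \<open>fail\<close> rejects a rule that leaves goals open, so that another is tried.\<close>
    by (elim disjE) (rule notE[OF dev1] notE[OF dev2] notE[OF dev3]; simp; fail)+
qed

theorem mainTheorem1:
  shows "finite_dg_game three_person_game
    \<and> terminals three_person_game = {a\<^sub>1, a\<^sub>2}
    \<and> card (outcomes three_person_game) = 5
    \<and> terminal_outcomes three_person_game = {A\<^sub>1, A\<^sub>2}
    \<and> cyclic_outcomes three_person_game = {C\<^sub>1, C\<^sub>2, C\<^sub>3}
    \<and> \<not> (\<exists>x. nash_equilibrium three_person_game x)
    \<and> rank_vector three_person_game = [1, 2, 1]
    \<and> \<not> (\<forall>g :: nat dg_game. finite_dg_game g \<and> \<not> (\<exists>x. nash_equilibrium g x)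
           \<longrightarrow> (\<exists>i \<in> players g. \<exists>j \<in> players g. i \<noteq> j \<and> rank g i \<ge> 2 \<and> rank g j \<ge> 2))"
proof -
  have "card (outcomes \<G>) = 5"
    by (simp add: outcomes_game outcome_neqs)
  \<comment> \<open>Player 2 alone has rank at least 2, so this game refutes the universal
    claim.\<close>
  moreover have "\<not> (\<exists>i \<in> players \<G>. \<exists>j \<in> players \<G>. i \<noteq> j \<and> rank \<G> i \<ge> 2 \<and> rank \<G> j \<ge> 2)"
    using rank_game by (auto simp: players_game)
  ultimately show ?thesis
    using finite_dg_game_game terminals_game terminal_outcomes_game cyclic_outcomes_game
      no_nash_equilibrium_game rank_vector_game by blast
qed

end
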